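(* The moduli space $M$ of primary Burniat surfaces over $\mathbb{C}$ is rational (i.e., birational to an affine space).
   Context: We work over $\mathbb{C}$. For $a_1,a_2,a_3 \in \mathbb{C}\setminus\{\pm 2\}$ and $c \in \mathbb{C}\setminus\{0\}$, let $E_j \subset \mathbb{P}(1,2,1)$ (with weighted homogeneous coordinates $x_j,y_j,z_j$) be the smooth curve of genus $1$ given by $y_j^2 = x_j^4 + a_j x_j^2 z_j^2 + z_j^4$, for $j=1,2,3$, and let $X = X_{(a_1,a_2,a_3,c)} \subset E_1\times E_2\times E_3$ be the surface given by $x_1x_2x_3 = c\, z_1z_2z_3$. Let $\Gamma = \langle \gamma_1,\gamma_2,\gamma_3\rangle \cong (\mathbb{Z}/2\mathbb{Z})^3$ act on $E_1\times E_2\times E_3$ (and on $X$) by sign changes of the coordinates (all $z_j$ unchanged): $\gamma_1$ maps $(x_1,y_1,x_2,y_2,x_3,y_3)$ to $(x_1,y_1,-x_2,-y_2,-x_3,y_3)$, $\gamma_2$ maps it to $(-x_1,y_1,x_2,y_2,-x_3,-y_3)$, and $\gamma_3$ maps it to $(-x_1,-y_1,-x_2,y_2,x_3,y_3)$. The action of $\Gamma$ on $X$ is free if and only if $X$ contains no point with $y_1=y_2=y_3=0$; in that case $X$ is smooth. A primary Burniat surface is a surface isomorphic to $S = X/\Gamma$ for such an $X$ on which $\Gamma$ acts freely (this agrees with Burniat's original construction as smooth bidouble covers of a del Pezzo surface of degree $6$). The moduli space $M$ is the corresponding connected component of the Gieseker moduli space of surfaces of general type. Explicitly, $M$ is the subset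 of $\mathbb{A}^6$ with coordinates $(u_1,u_2,u_3,d,v,w)$ given by $-4 u_1^3 u_3 + u_1^2 u_2^2 + 18 u_1 u_2 u_3 - 4 u_2^3 - 27 u_3^2 = d^2$, $u_3 v = w^2$, $(v - u_1)^2 + u_2 (v - 4) + u_3 + (u_1 + v - 8) w \neq 0$, $64 - 16 u_1 + 4 u_2 - u_3 \neq 0$, where the class of $X_{(a_1,a_2,a_3,c)}/\Gamma$ has coordinates $u_1,u_2,u_3$ equal to the elementary symmetric polynomials (of degrees $1,2,3$) in $a_1^2,a_2^2,a_3^2$, $d = (a_1^2-a_2^2)(a_2^2-a_3^2)(a_3^2-a_1^2)$, $v = (c^2+c^{-2})^2$, $w = a_1a_2a_3(c^2+c^{-2})$. *)

theory Defs
  imports "HOL-Analysis.Analysis" "HOL-Computational_Algebra.Computational_Algebra"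
begin

text \<open>
  Quasi-affine varieties over the complex numbers. A point of affine \<open>n\<close>-space is the list
  of its \<open>n\<close> coordinates, so that the dimension is an ordinary natural number. As the ground field
  is infinite, polynomials are identified with the functions they define.
\<close>

definition affine_space :: "nat \<Rightarrow> complex list set" where
  "affine_space n = {p. length p = n}"

inductive_set polynomial_functions :: "nat \<Rightarrow> (complex list \<Rightarrow> complex) set" for n :: nat where
  const: "(\<lambda>_. a) \<in> polynomial_functions n"
| coord: "i < n \<Longrightarrow> (\<lambda>p. p ! i) \<in> polynomial_functions n"
| add: "f \<in> polynomial_functions n \<Longrightarrow> g \<in> polynomial_functions n
    \<Longrightarrow> (\<lambda>p. f p + g p) \<in> polynomial_functions n"
| mult: "f \<in> polynomial_functions n \<Longrightarrow> g \<in> polynomial_functions n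
    \<Longrightarrow> (\<lambda>p. f p * g p) \<in> polynomial_functions n"

definition zero_locus :: "nat \<Rightarrow> (complex list \<Rightarrow> complex) set \<Rightarrow> complex list set" where
  "zero_locus n F = {p \<in> affine_space n. \<forall>f\<in>F. f p = 0}"

definition zariski :: "nat \<Rightarrow> complex list topology" where
  "zariski n = topology
     (\<lambda>U. \<exists>F\<subseteq>polynomial_functions n. U = affine_space n - zero_locus n F)"

lemma istopology_zariski:
  "istopology (\<lambda>U. \<exists>F\<subseteq>polynomial_functions n. U = affine_space n - zero_locus n F)"
  unfolding istopology_def
proof (intro conjI allI impI)
  fix S T
  assume "\<exists>F\<subseteq>polynomial_functions n. S = affine_space n - zero_locus n F"
    and "\<exists>F\<subseteq>polynomial_functions n. T = affine_space n - zero_locus n F"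
  then obtain F G where F: "F \<subseteq> polynomial_functions n" "S = affine_space n - zero_locus n F"
    and G: "G \<subseteq> polynomial_functions n" "T = affine_space n - zero_locus n G" by blast
  define H where "H = {\<lambda>p. f p * g p |f g. f \<in> F \<and> g \<in> G}"
  have "H \<subseteq> polynomial_functions n"
    using F G unfolding H_def by (auto intro: polynomial_functions.mult)
  moreover have "S \<inter> T = affine_space n - zero_locus n H"
  proof (intro equalityI subsetI)
    fix p assume p: "p \<in> S \<inter> T"
    then obtain f g where fg: "f \<in> F" "g \<in> G" "f p \<noteq> 0" "g p \<noteq> 0" "p \<in> affine_space n"
      using F G by (auto simp: zero_locus_def)
    then have H: "(\<lambda>p. f p * g p) \<in> H" and nz: "f p * g p \<noteq> 0" by (auto simp: H_def)
    have "\<not> (\<forall>k\<in>H. k p = 0)" using bspec[OF _ H] nz by blast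
    then show "p \<in> affine_space n - zero_locus n H"
      using fg(5) by (simp add: zero_locus_def)
  next
    fix p assume "p \<in> affine_space n - zero_locus n H"
    then show "p \<in> S \<inter> T"
      using F G by (auto simp: zero_locus_def H_def)
  qed
  ultimately show "\<exists>F\<subseteq>polynomial_functions n. S \<inter> T = affine_space n - zero_locus n F"
    by blast
next
  fix K :: "complex list set set"
  assume K: "\<forall>U\<in>K. \<exists>F\<subseteq>polynomial_functions n. U = affine_space n - zero_locus n F"
  then obtain F where F: "\<And>U. U \<in> K \<Longrightarrow> F U \<subseteq> polynomial_functions n"
      "\<And>U. U \<in> K \<Longrightarrow> U = affine_space n - zero_locus n (F U)" by metis
  have "(\<Union>U\<in>K. F U) \<subseteq> polynomial_functions n" using F by blast
  moreover have "\<Union>K = affine_space n - zero_locus n (\<Union>U\<in>K. F U)"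
  proof -
    have "\<Union>K = (\<Union>U\<in>K. affine_space n - zero_locus n (F U))" using F(2) by auto
    also have "\<dots> = affine_space n - zero_locus n (\<Union>U\<in>K. F U)" by (auto simp: zero_locus_def)
    finally show ?thesis .
  qed
  ultimately show "\<exists>F\<subseteq>polynomial_functions n. \<Union>K = affine_space n - zero_locus n F"
    by blast
qed

lemma openin_zariski:
  "openin (zariski n) U \<longleftrightarrow>
     (\<exists>F\<subseteq>polynomial_functions n. U = affine_space n - zero_locus n F)"
  unfolding zariski_def by (simp add: topology_inverse' istopology_zariski)

lemma topspace_zariski: "topspace (zariski n) = affine_space n"
proof -
  have "openin (zariski n) (affine_space n)"
    unfolding openin_zariski
    by (rule exI[of _ "{\<lambda>_. 1}"]) (auto simp: zero_locus_def intro: polynomial_functions.const)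
  then show ?thesis
    unfolding topspace_def by (intro equalityI subsetI) (force simp: openin_zariski, blast)
qed

definition zariski_irreducible :: "nat \<Rightarrow> complex list set \<Rightarrow> bool" where
  "zariski_irreducible n V \<longleftrightarrow> V \<noteq> {} \<and>
     (\<forall>A B. closedin (subtopology (zariski n) V) A \<longrightarrow> closedin (subtopology (zariski n) V) B
        \<longrightarrow> V = A \<union> B \<longrightarrow> A = V \<or> B = V)"

definition quasi_affine_variety :: "nat \<Rightarrow> complex list set \<Rightarrow> bool" where
  "quasi_affine_variety n V \<longleftrightarrow>
     (\<exists>C U. closedin (zariski n) C \<and> openin (zariski n) U \<and> V = C \<inter> U)
     \<and> zariski_irreducible n V"

definition regular_function ::
  "nat \<Rightarrow> complex list set \<Rightarrow> (complex list \<Rightarrow> complex) \<Rightarrow> bool" where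
  "regular_function n V f \<longleftrightarrow>
     (\<forall>p\<in>V. \<exists>D. openin (subtopology (zariski n) V) D \<and> p \<in> D \<and>
        (\<exists>g\<in>polynomial_functions n. \<exists>h\<in>polynomial_functions n.
           \<forall>q\<in>D. h q \<noteq> 0 \<and> f q = g q / h q))"

definition morphism ::
  "nat \<Rightarrow> complex list set \<Rightarrow> nat \<Rightarrow> complex list set \<Rightarrow> (complex list \<Rightarrow> complex list) \<Rightarrow> bool" where
  "morphism n V m W \<phi> \<longleftrightarrow>
     \<phi> ` V \<subseteq> W \<and> (\<forall>i<m. regular_function n V (\<lambda>p. \<phi> p ! i))"

definition isomorphic_varieties ::
  "nat \<Rightarrow> complex list set \<Rightarrow> nat \<Rightarrow> complex list set \<Rightarrow> bool" where
  "isomorphic_varieties n V m W \<longleftrightarrow>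
     (\<exists>\<phi> \<psi>. morphism n V m W \<phi> \<and> morphism m W n V \<psi> \<and>
        (\<forall>p\<in>V. \<psi> (\<phi> p) = p) \<and> (\<forall>q\<in>W. \<phi> (\<psi> q) = q))"

text \<open>For irreducible varieties every nonempty open subset is dense.\<close>

definition birational ::
  "nat \<Rightarrow> complex list set \<Rightarrow> nat \<Rightarrow> complex list set \<Rightarrow> bool" where
  "birational n V m W \<longleftrightarrow>
     quasi_affine_variety n V \<and> quasi_affine_variety m W \<and>
     (\<exists>V' W'. openin (subtopology (zariski n) V) V' \<and> V' \<noteq> {} \<and>
        openin (subtopology (zariski m) W) W' \<and> W' \<noteq> {} \<and>
        isomorphic_varieties n V' m W')"

definition rational_variety :: "nat \<Rightarrow> complex list set \<Rightarrow> bool" where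
  "rational_variety n V \<longleftrightarrow> (\<exists>m. birational n V m (affine_space m))"

text \<open>
  The moduli space of primary Burniat surfaces, as a subset of affine 6-space. Its points are the
  classes of the quotients \<open>X / \<Gamma>\<close>, where \<open>X\<close> has parameters \<open>(a1, a2, a3, c)\<close>: the numbers
  \<open>u1, u2, u3\<close> are the elementary symmetric polynomials in the squares of the \<open>ai\<close>, the left-hand
  side of the first equation is the discriminant of \<open>T^3 - u1 T^2 + u2 T - u3\<close>, the first
  inequation says that \<open>\<Gamma>\<close> acts freely on \<open>X\<close>, and the second one that no \<open>ai\<close> is \<open>\<plusminus> 2\<close>.
\<close>

definition burniat_moduli_space :: "complex list set" where
  "burniat_moduli_space = {[u1, u2, u3, d, v, w] |u1 u2 u3 d v w.
     - 4 * u1^3 * u3 + u1^2 * u2^2 + 18 * u1 * u2 * u3 - 4 * u2^3 - 27 * u3^2 = d^2 \<and>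
     u3 * v = w^2 \<and>
     (v - u1)^2 + u2 * (v - 4) + u3 + (u1 + v - 8) * w \<noteq> 0 \<and>
     64 - 16 * u1 + 4 * u2 - u3 \<noteq> 0}"

text \<open>
  The set \<open>burniat_moduli_space\<close> is exactly the set of coordinate vectors attached to the primary
  Burniat surfaces; this is the theorem \<open>burniat_moduli_space_eq_image\<close> below. A point of \<open>\<bbbP>(1,2,1)\<close> is given by weighted homogeneous
  coordinates \<open>(x, y, z)\<close>; on the curves below \<open>x = z = 0\<close> would force \<open>y = 0\<close>.
\<close>

type_synonym wpoint = "complex \<times> complex \<times> complex"

fun same_wpoint :: "wpoint \<Rightarrow> wpoint \<Rightarrow> bool" where
  "same_wpoint (x, y, z) (x', y', z') \<longleftrightarrow>
     (\<exists>l. l \<noteq> 0 \<and> x' = l * x \<and> y' = l^2 * y \<and> z' = l * z)"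

definition burniat_curve :: "complex \<Rightarrow> wpoint set" where
  "burniat_curve a = {(x, y, z). (x, y, z) \<noteq> (0, 0, 0) \<and> y^2 = x^4 + a * x^2 * z^2 + z^4}"

definition burniat_cover ::
  "complex \<Rightarrow> complex \<Rightarrow> complex \<Rightarrow> complex \<Rightarrow> (wpoint \<times> wpoint \<times> wpoint) set" where
  "burniat_cover a1 a2 a3 c =
     {((x1, y1, z1), (x2, y2, z2), (x3, y3, z3)) |x1 y1 z1 x2 y2 z2 x3 y3 z3.
        (x1, y1, z1) \<in> burniat_curve a1 \<and> (x2, y2, z2) \<in> burniat_curve a2 \<and>
        (x3, y3, z3) \<in> burniat_curve a3 \<and> x1 * x2 * x3 = c * (z1 * z2 * z3)}"

fun same_wpoint3 :: "wpoint \<times> wpoint \<times> wpoint \<Rightarrow> wpoint \<times> wpoint \<times> wpoint \<Rightarrow> bool" where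
  "same_wpoint3 (p1, p2, p3) (q1, q2, q3) \<longleftrightarrow>
     same_wpoint p1 q1 \<and> same_wpoint p2 q2 \<and> same_wpoint p3 q3"

fun gamma1 gamma2 gamma3 :: "wpoint \<times> wpoint \<times> wpoint \<Rightarrow> wpoint \<times> wpoint \<times> wpoint" where
  "gamma1 ((x1, y1, z1), (x2, y2, z2), (x3, y3, z3)) =
     ((x1, y1, z1), (- x2, - y2, z2), (- x3, y3, z3))"
| "gamma2 ((x1, y1, z1), (x2, y2, z2), (x3, y3, z3)) =
     ((- x1, y1, z1), (x2, y2, z2), (- x3, - y3, z3))"
| "gamma3 ((x1, y1, z1), (x2, y2, z2), (x3, y3, z3)) =
     ((- x1, - y1, z1), (- x2, y2, z2), (x3, y3, z3))"

definition gamma_acts_freely :: "complex \<Rightarrow> complex \<Rightarrow> complex \<Rightarrow> complex \<Rightarrow> bool" where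
  "gamma_acts_freely a1 a2 a3 c \<longleftrightarrow>
     (\<forall>i<2. \<forall>j<2. \<forall>k<2. (i, j, k) \<noteq> (0, 0, 0) \<longrightarrow>
        (\<forall>P\<in>burniat_cover a1 a2 a3 c.
           \<not> same_wpoint3 ((gamma1 ^^ i) ((gamma2 ^^ j) ((gamma3 ^^ k) P))) P))"

definition burniat_parameters :: "(complex \<times> complex \<times> complex \<times> complex) set" where
  "burniat_parameters = {(a1, a2, a3, c). {a1, a2, a3} \<inter> {2, - 2} = {} \<and> c \<noteq> 0 \<and>
     gamma_acts_freely a1 a2 a3 c}"

definition moduli_coordinates :: "complex \<times> complex \<times> complex \<times> complex \<Rightarrow> complex list" where
  "moduli_coordinates = (\<lambda>(a1, a2, a3, c).
     [a1^2 + a2^2 + a3^2,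
      a1^2 * a2^2 + a1^2 * a3^2 + a2^2 * a3^2,
      a1^2 * a2^2 * a3^2,
      (a1^2 - a2^2) * (a2^2 - a3^2) * (a3^2 - a1^2),
      (c^2 + inverse (c^2))^2,
      a1 * a2 * a3 * (c^2 + inverse (c^2))])"

lemma same_wpoint_flip:
  assumes "(x, y, z) \<in> burniat_curve a"
  shows "\<not> same_wpoint (- x, - y, z) (x, y, z)"
    and "same_wpoint (x, - y, z) (x, y, z) \<longleftrightarrow> y = 0"
proof -
  have nz: "(x, y, z) \<noteq> (0, 0, 0)" and eq: "y^2 = x^4 + a * x^2 * z^2 + z^4"
    using assms by (auto simp: burniat_curve_def)
  show "\<not> same_wpoint (- x, - y, z) (x, y, z)"
  proof
    assume "same_wpoint (- x, - y, z) (x, y, z)"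
    then obtain l where l: "l \<noteq> 0" "x = - (l * x)" "y = - (l^2 * y)" "z = l * z" by auto
    have z: "z = 0 \<or> l = 1" using l by auto
    have "x = 0 \<or> l = - 1"
      using l(2) by (metis minus_mult_left mult_cancel_right mult_1 minus_equation_iff)
    then have "(x = 0 \<and> (z = 0 \<or> l = 1)) \<or> (z = 0 \<and> l = - 1)" using z by auto
    moreover have "y = 0" if "l = 1 \<or> l = - 1" using that l(3) by auto
    ultimately show False using nz eq by auto
  qed
  show "same_wpoint (x, - y, z) (x, y, z) \<longleftrightarrow> y = 0"
  proof
    assume "same_wpoint (x, - y, z) (x, y, z)"
    then obtain l where l: "l \<noteq> 0" "x = l * x" "y = - (l^2 * y)" "z = l * z" by auto
    show "y = 0"
    proof (cases "x = 0 \<and> z = 0")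
      case True then show ?thesis using eq by simp
    next
      case False then have "l = 1" using l by auto
      then show ?thesis using l(3) by simp
    qed
  next
    assume "y = 0" then show "same_wpoint (x, - y, z) (x, y, z)" by (auto intro!: exI[of _ 1])
  qed
qed

lemma gamma_acts_freely_iff:
  "gamma_acts_freely a1 a2 a3 c \<longleftrightarrow>
     \<not> (\<exists>x1 z1 x2 z2 x3 z3.
          ((x1, 0, z1), (x2, 0, z2), (x3, 0, z3)) \<in> burniat_cover a1 a2 a3 c)"
proof
  assume free: "gamma_acts_freely a1 a2 a3 c"
  show "\<not> (\<exists>x1 z1 x2 z2 x3 z3.
          ((x1, 0, z1), (x2, 0, z2), (x3, 0, z3)) \<in> burniat_cover a1 a2 a3 c)"
  proof
    assume "\<exists>x1 z1 x2 z2 x3 z3.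
          ((x1, 0, z1), (x2, 0, z2), (x3, 0, z3)) \<in> burniat_cover a1 a2 a3 c"
    then obtain x1 z1 x2 z2 x3 z3 where
      P: "((x1, 0, z1), (x2, 0, z2), (x3, 0, z3)) \<in> burniat_cover a1 a2 a3 c" by blast
    have "\<not> same_wpoint3
        ((gamma1 ^^ 1) ((gamma2 ^^ 1) ((gamma3 ^^ 1) ((x1, 0, z1), (x2, 0, z2), (x3, 0, z3)))))
        ((x1, 0, z1), (x2, 0, z2), (x3, 0, z3))"
      using free P unfolding gamma_acts_freely_def by (metis Pair_inject one_less_numeral_iff
        semiring_norm(76) zero_neq_one)
    then show False by (auto dest: spec[of _ 1])
  qed
next
  assume nopt: "\<not> (\<exists>x1 z1 x2 z2 x3 z3.
          ((x1, 0, z1), (x2, 0, z2), (x3, 0, z3)) \<in> burniat_cover a1 a2 a3 c)"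
  show "gamma_acts_freely a1 a2 a3 c"
    unfolding gamma_acts_freely_def
  proof (intro allI impI ballI)
    fix i j k :: nat and P
    assume ijk: "i < 2" "j < 2" "k < 2" "(i, j, k) \<noteq> (0, 0, 0)"
      and P: "P \<in> burniat_cover a1 a2 a3 c"
    obtain x1 y1 z1 x2 y2 z2 x3 y3 z3 where
      Peq: "P = ((x1, y1, z1), (x2, y2, z2), (x3, y3, z3))"
      and cur: "(x1, y1, z1) \<in> burniat_curve a1" "(x2, y2, z2) \<in> burniat_curve a2"
        "(x3, y3, z3) \<in> burniat_curve a3"
      using P unfolding burniat_cover_def by blast
    have y: "\<not> (y1 = 0 \<and> y2 = 0 \<and> y3 = 0)"
      using nopt P Peq by blast
    have i: "i = 0 \<or> i = 1" and j: "j = 0 \<or> j = 1" and k: "k = 0 \<or> k = 1" using ijk by auto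
    note f = same_wpoint_flip[OF cur(1)] same_wpoint_flip[OF cur(2)] same_wpoint_flip[OF cur(3)]
    show "\<not> same_wpoint3 ((gamma1 ^^ i) ((gamma2 ^^ j) ((gamma3 ^^ k) P))) P"
      using i j k ijk(4) y f unfolding Peq
      by (elim disjE) (simp_all del: same_wpoint.simps)
  qed
qed

lemma burniat_discriminant:
  fixes a1 a2 a3 c :: complex
  assumes c: "c \<noteq> 0"
  defines "b \<equiv> c^2 + inverse (c^2)"
  shows "(\<exists>x1 z1 x2 z2 x3 z3.
          ((x1, 0, z1), (x2, 0, z2), (x3, 0, z3)) \<in> burniat_cover a1 a2 a3 c) \<longleftrightarrow>
     (b^2 - (a1^2 + a2^2 + a3^2))^2 + (a1^2 * a2^2 + a1^2 * a3^2 + a2^2 * a3^2) * (b^2 - 4)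
       + a1^2 * a2^2 * a3^2 + ((a1^2 + a2^2 + a3^2) + b^2 - 8) * (a1 * a2 * a3 * b) = 0"
    (is "?L \<longleftrightarrow> ?E = 0")
proof -
  have root: "\<exists>s. s \<noteq> 0 \<and> a = - (s + inverse s)" for a :: complex
  proof -
    define s where "s = (- a + csqrt (a^2 - 4)) / 2"
    have "(2 * s + a)^2 = a^2 - 4" unfolding s_def by (simp add: field_simps)
    then have "4 * (s * s + a * s + 1) = 0" by (simp add: power2_eq_square algebra_simps)
    then have e: "s * s + a * s + 1 = 0" by (metis mult_eq_0_iff zero_neq_numeral)
    then have "s \<noteq> 0" by auto
    moreover have "a = - (s + inverse s)"
    proof -
      have "s * (- (s + inverse s)) = - (s * s + 1)" using \<open>s \<noteq> 0\<close> by (simp add: algebra_simps)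
      moreover have "s * a = (s * s + a * s + 1) - (s * s + 1)" by (simp add: algebra_simps)
      ultimately have "s * a = s * (- (s + inverse s))" unfolding e by simp
      then show ?thesis using \<open>s \<noteq> 0\<close> by simp
    qed
    ultimately show ?thesis by blast
  qed
  obtain s1 s2 s3 where s: "s1 \<noteq> 0" "s2 \<noteq> 0" "s3 \<noteq> 0"
    "a1 = - (s1 + inverse s1)" "a2 = - (s2 + inverse s2)" "a3 = - (s3 + inverse s3)"
    using root by metis
  define P Q where "P = s2 * s3 + inverse (s2 * s3)" and "Q = s2 * inverse s3 + inverse s2 * s3"
  have PQ: "P + Q = a2 * a3" "P * Q = a2^2 + a3^2 - 4"
    unfolding P_def Q_def s using s by (simp_all add: field_simps power2_eq_square)
  have *: "?E = (b^2 + a1 * P * b + a1^2 + P^2 - 4) * (b^2 + a1 * Q * b + a1^2 + Q^2 - 4)"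
  proof -
    have "(b^2 + a1 * P * b + a1^2 + P^2 - 4) * (b^2 + a1 * Q * b + a1^2 + Q^2 - 4)
      = (b^2 + a1^2 - 4)^2 + (b^2 + a1^2 - 4) * (a1 * b) * (P + Q)
        + (b^2 + a1^2 - 4) * ((P + Q)^2 - 2 * (P * Q))
        + (a1 * b)^2 * (P * Q) + a1 * b * (P + Q) * (P * Q) + (P * Q)^2"
      by algebra
    also have "\<dots> = ?E" unfolding PQ by algebra
    finally show ?thesis by simp
  qed
  have pair: "b^2 + a1 * (t + inverse t) * b + a1^2 + (t + inverse t)^2 - 4
      = (b - (s1 * t + inverse (s1 * t))) * (b - (s1 * inverse t + inverse s1 * t))"
    if "t \<noteq> 0" for t
    unfolding s using s(1) that by (simp add: field_simps power2_eq_square)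
  have lin: "b - (r + inverse r) = 0 \<longleftrightarrow> c^2 = r \<or> c^2 = inverse r" if "r \<noteq> 0" for r
  proof -
    have "c^2 * r * (b - (r + inverse r)) = (c^2 - r) * (c^2 * r - 1)"
      unfolding b_def using c that by (simp add: field_simps power2_eq_square)
    moreover have "c^2 * r \<noteq> 0" using c that by simp
    ultimately have "b - (r + inverse r) = 0 \<longleftrightarrow> (c^2 - r) * (c^2 * r - 1) = 0"
      by (metis mult_eq_0_iff)
    also have "\<dots> \<longleftrightarrow> c^2 = r \<or> c^2 = inverse r"
    proof -
      have "c^2 * r - 1 = 0 \<longleftrightarrow> c^2 = inverse r"
        using that by (simp add: inverse_eq_divide eq_divide_eq)
      then show ?thesis unfolding mult_eq_0_iff by simp
    qed
    finally show ?thesis .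
  qed
  have E0: "?E = 0 \<longleftrightarrow> (\<exists>e1 e2 e3. e1 \<in> {s1, inverse s1} \<and> e2 \<in> {s2, inverse s2} \<and>
      e3 \<in> {s3, inverse s3} \<and> c^2 = e1 * e2 * e3)"
  proof -
    have Q': "Q = s2 * inverse s3 + inverse (s2 * inverse s3)"
      unfolding Q_def using s by (simp add: field_simps)
    have i: "s1 * inverse t + inverse s1 * t = s1 * inverse t + inverse (s1 * inverse t)" for t
      by simp
    have "?E = 0 \<longleftrightarrow>
       (b - (s1 * (s2 * s3) + inverse (s1 * (s2 * s3))) = 0 \<or>
        b - (s1 * inverse (s2 * s3) + inverse (s1 * inverse (s2 * s3))) = 0) \<or>
       (b - (s1 * (s2 * inverse s3) + inverse (s1 * (s2 * inverse s3))) = 0 \<or>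
        b - (s1 * inverse (s2 * inverse s3) + inverse (s1 * inverse (s2 * inverse s3))) = 0)"
      unfolding * Q' P_def
      by (subst pair, use s in simp, subst pair, use s in simp) (simp only: mult_eq_0_iff i)
    also have "\<dots> \<longleftrightarrow> (\<exists>e1 e2 e3. e1 \<in> {s1, inverse s1} \<and> e2 \<in> {s2, inverse s2} \<and>
      e3 \<in> {s3, inverse s3} \<and> c^2 = e1 * e2 * e3)"
    proof -
      have "s1 * (s2 * s3) \<noteq> 0" "s1 * inverse (s2 * s3) \<noteq> 0"
        "s1 * (s2 * inverse s3) \<noteq> 0" "s1 * inverse (s2 * inverse s3) \<noteq> 0"
        using s(1-3) by simp_all
      note l = this[THEN lin]
      show ?thesis unfolding l by (simp add: mult.assoc conj_disj_distribR ex_disj_distrib) blast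
    qed
    finally show ?thesis .
  qed
  have quad: "t^2 + a * t + 1 = 0 \<longleftrightarrow> t \<in> {s, inverse s}"
    if "s \<noteq> 0" "a = - (s + inverse s)" for s a t :: complex
  proof -
    have "t^2 + a * t + 1 = t^2 - (s + inverse s) * t + s * inverse s"
      unfolding that(2) using that(1) by (simp add: algebra_simps)
    also have "\<dots> = (t - s) * (t - inverse s)" by algebra
    finally have "t^2 + a * t + 1 = (t - s) * (t - inverse s)" .
    then show ?thesis by simp
  qed
  have L: "?L \<longleftrightarrow> (\<exists>e1 e2 e3. e1^2 + a1 * e1 + 1 = 0 \<and> e2^2 + a2 * e2 + 1 = 0 \<and>
      e3^2 + a3 * e3 + 1 = 0 \<and> c^2 = e1 * e2 * e3)"
  proof
    assume ?L
    then obtain x1 z1 x2 z2 x3 z3 where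
      cur: "(x1, 0, z1) \<in> burniat_curve a1" "(x2, 0, z2) \<in> burniat_curve a2"
        "(x3, 0, z3) \<in> burniat_curve a3" and eq: "x1 * x2 * x3 = c * (z1 * z2 * z3)"
      unfolding burniat_cover_def by auto
    have z: "z \<noteq> 0 \<and> ((x / z)^2)^2 + a * (x / z)^2 + 1 = 0"
      if "(x, 0, z) \<in> burniat_curve a" for x z a
    proof -
      have nz: "z \<noteq> 0" and e: "x^4 + a * x^2 * z^2 + z^4 = 0"
        using that by (auto simp: burniat_curve_def)
      have "((x / z)^2)^2 + a * (x / z)^2 + 1 = (x^4 + a * x^2 * z^2 + z^4) / z^4"
        using nz by (simp add: field_simps power2_eq_square power4_eq_xxxx)
      then show ?thesis using nz e by simp
    qed
    have "c = (x1 / z1) * (x2 / z2) * (x3 / z3)"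
      using z[OF cur(1)] z[OF cur(2)] z[OF cur(3)] eq by (simp add: field_simps)
    then have "c^2 = (x1 / z1)^2 * (x2 / z2)^2 * (x3 / z3)^2"
      by (simp only: power_mult_distrib)
    then show "\<exists>e1 e2 e3. e1^2 + a1 * e1 + 1 = 0 \<and> e2^2 + a2 * e2 + 1 = 0 \<and>
      e3^2 + a3 * e3 + 1 = 0 \<and> c^2 = e1 * e2 * e3"
      using z[OF cur(1)] z[OF cur(2)] z[OF cur(3)] by blast
  next
    assume "\<exists>e1 e2 e3. e1^2 + a1 * e1 + 1 = 0 \<and> e2^2 + a2 * e2 + 1 = 0 \<and>
      e3^2 + a3 * e3 + 1 = 0 \<and> c^2 = e1 * e2 * e3"
    then obtain e1 e2 e3 where e: "e1^2 + a1 * e1 + 1 = 0" "e2^2 + a2 * e2 + 1 = 0"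
      "e3^2 + a3 * e3 + 1 = 0" "c^2 = e1 * e2 * e3" by blast
    have "(csqrt e1 * csqrt e2 * csqrt e3)^2 = c^2" using e(4) by (simp add: power_mult_distrib)
    then have "csqrt e1 * csqrt e2 * csqrt e3 = c \<or> csqrt e1 * csqrt e2 * csqrt e3 = - c"
      unfolding power2_eq_iff .
    then obtain g :: complex where g: "g^2 = 1" "g * csqrt e1 * csqrt e2 * csqrt e3 = c"
    proof (elim disjE)
      assume "csqrt e1 * csqrt e2 * csqrt e3 = c" then show ?thesis using that[of 1] by simp
    next
      assume "csqrt e1 * csqrt e2 * csqrt e3 = - c" then show ?thesis using that[of "- 1"] by simp
    qed
    have pt: "(x, 0, 1) \<in> burniat_curve a" if "t^2 + a * t + 1 = 0" "x^2 = t" for x t a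
    proof -
      have "x^4 = t^2" by (simp add: that(2)[symmetric] power_mult[symmetric])
      then show ?thesis using that by (simp add: burniat_curve_def)
    qed
    have "((g * csqrt e1, 0, 1), (csqrt e2, 0, 1), (csqrt e3, 0, 1)) \<in> burniat_cover a1 a2 a3 c"
      using pt[OF e(1), of "g * csqrt e1"] pt[OF e(2), of "csqrt e2"] pt[OF e(3), of "csqrt e3"] g
      by (auto simp: burniat_cover_def power_mult_distrib)
    then show ?L by blast
  qed
  show ?thesis unfolding L E0 quad[OF s(1,4)] quad[OF s(2,5)] quad[OF s(3,6)] ..
qed

theorem burniat_moduli_space_eq_image:
  "burniat_moduli_space = moduli_coordinates ` burniat_parameters"
proof (intro equalityI subsetI)
  fix p assume "p \<in> moduli_coordinates ` burniat_parameters"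
  then obtain a1 a2 a3 c where p: "p = moduli_coordinates (a1, a2, a3, c)"
    and a: "{a1, a2, a3} \<inter> {2, - 2} = {}" and c: "c \<noteq> 0"
    and free: "gamma_acts_freely a1 a2 a3 c"
    unfolding burniat_parameters_def by blast
  define b where "b = c^2 + inverse (c^2)"
  have sq: "4 - x^2 \<noteq> 0" if "x \<notin> {2, - 2}" for x :: complex
  proof -
    have "4 - x^2 = (2 - x) * (2 + x)" by algebra
    moreover have "2 - x \<noteq> 0" "2 + x \<noteq> 0" using that by (auto simp: add_eq_0_iff)
    ultimately show ?thesis by simp
  qed
  have "(4 - a1^2) * (4 - a2^2) * (4 - a3^2) \<noteq> 0" using a sq by auto
  moreover have "(4 - a1^2) * (4 - a2^2) * (4 - a3^2) = 64 - 16 * (a1^2 + a2^2 + a3^2)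
      + 4 * (a1^2 * a2^2 + a1^2 * a3^2 + a2^2 * a3^2) - a1^2 * a2^2 * a3^2" by algebra
  ultimately have 4: "64 - 16 * (a1^2 + a2^2 + a3^2)
      + 4 * (a1^2 * a2^2 + a1^2 * a3^2 + a2^2 * a3^2) - a1^2 * a2^2 * a3^2 \<noteq> 0" by simp
  have 3: "(b^2 - (a1^2 + a2^2 + a3^2))^2 + (a1^2 * a2^2 + a1^2 * a3^2 + a2^2 * a3^2) * (b^2 - 4)
       + a1^2 * a2^2 * a3^2 + ((a1^2 + a2^2 + a3^2) + b^2 - 8) * (a1 * a2 * a3 * b) \<noteq> 0"
    using free unfolding gamma_acts_freely_iff burniat_discriminant[OF c] b_def .
  have 1: "- 4 * (a1^2 + a2^2 + a3^2)^3 * (a1^2 * a2^2 * a3^2)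
      + (a1^2 + a2^2 + a3^2)^2 * (a1^2 * a2^2 + a1^2 * a3^2 + a2^2 * a3^2)^2
      + 18 * (a1^2 + a2^2 + a3^2) * (a1^2 * a2^2 + a1^2 * a3^2 + a2^2 * a3^2) * (a1^2 * a2^2 * a3^2)
      - 4 * (a1^2 * a2^2 + a1^2 * a3^2 + a2^2 * a3^2)^3 - 27 * (a1^2 * a2^2 * a3^2)^2
      = ((a1^2 - a2^2) * (a2^2 - a3^2) * (a3^2 - a1^2))^2" by algebra
  have 2: "a1^2 * a2^2 * a3^2 * b^2 = (a1 * a2 * a3 * b)^2" by algebra
  show "p \<in> burniat_moduli_space"
    unfolding burniat_moduli_space_def p moduli_coordinates_def prod.case b_def[symmetric]
    using 1 2 3 4 by blast
next
  fix p assume "p \<in> burniat_moduli_space"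
  then obtain u1 u2 u3 d v w where p: "p = [u1, u2, u3, d, v, w]"
    and h1: "- 4 * u1^3 * u3 + u1^2 * u2^2 + 18 * u1 * u2 * u3 - 4 * u2^3 - 27 * u3^2 = d^2"
    and h2: "u3 * v = w^2"
    and h3: "(v - u1)^2 + u2 * (v - 4) + u3 + (u1 + v - 8) * w \<noteq> 0"
    and h4: "64 - 16 * u1 + 4 * u2 - u3 \<noteq> 0"
    unfolding burniat_moduli_space_def by blast
  have "\<exists>r1 r2 r3. u1 = r1 + r2 + r3 \<and> u2 = r1 * r2 + r1 * r3 + r2 * r3 \<and> u3 = r1 * r2 * r3"
  proof -
    have "\<not> constant (poly [:- u3, u2, - u1, 1:])" by (simp add: constant_degree)
    then obtain r1 where r1: "poly [:- u3, u2, - u1, 1:] r1 = 0"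
      using fundamental_theorem_of_algebra by blast
    define f g where "f = u1 - r1" and "g = u2 - r1 * f"
    define r2 where "r2 = (f + csqrt (f^2 - 4 * g)) / 2"
    have "(2 * r2 - f)^2 = f^2 - 4 * g" unfolding r2_def by (simp add: field_simps)
    then have "4 * (r2 * (f - r2) - g) = 0" by (simp add: power2_eq_square algebra_simps)
    then have g: "g = r2 * (f - r2)" by simp
    have "u1 = r1 + r2 + (f - r2)" by (simp add: f_def)
    moreover have "u2 = r1 * r2 + r1 * (f - r2) + r2 * (f - r2)"
      using g g_def by (simp add: algebra_simps)
    moreover have "u3 = r1 * r2 * (f - r2)"
    proof -
      have "u3 = r1 * g" using r1 unfolding g_def f_def by (simp add: algebra_simps)
      then show ?thesis using g by simp
    qed
    ultimately show ?thesis by blast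
  qed
  then obtain r1 r2 r3 where
    r: "u1 = r1 + r2 + r3" "u2 = r1 * r2 + r1 * r3 + r2 * r3" "u3 = r1 * r2 * r3" by blast
  have "d^2 = ((r1 - r2) * (r2 - r3) * (r3 - r1))^2" using h1 unfolding r by algebra
  then have "d = (r1 - r2) * (r2 - r3) * (r3 - r1) \<or> d = (r2 - r1) * (r1 - r3) * (r3 - r2)"
    unfolding power2_eq_iff by (auto simp: algebra_simps)
  moreover have "u1 = r2 + r1 + r3" "u2 = r2 * r1 + r2 * r3 + r1 * r3" "u3 = r2 * r1 * r3"
    using r by (simp_all add: algebra_simps)
  ultimately obtain q1 q2 q3 where
    q: "u1 = q1 + q2 + q3" "u2 = q1 * q2 + q1 * q3 + q2 * q3" "u3 = q1 * q2 * q3"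
      "d = (q1 - q2) * (q2 - q3) * (q3 - q1)" using r by blast
  define a1 a2 a3 where "a1 = csqrt q1" and "a2 = csqrt q2" and "a3 = csqrt q3"
  have a: "q1 = a1^2" "q2 = a2^2" "q3 = a3^2" by (simp_all add: a1_def a2_def a3_def)
  have "(a1 * a2 * a3 * csqrt v)^2 = w^2"
    using h2 q(3) a by (simp add: power_mult_distrib)
  then have "w = a1 * a2 * a3 * csqrt v \<or> w = a1 * a2 * a3 * (- csqrt v)"
    unfolding power2_eq_iff by auto
  then obtain b where b: "w = a1 * a2 * a3 * b" "v = b^2"
  proof (elim disjE)
    assume "w = a1 * a2 * a3 * csqrt v" then show ?thesis using that[of "csqrt v"] by simp
  next
    assume "w = a1 * a2 * a3 * (- csqrt v)" then show ?thesis using that[of "- csqrt v"] by simp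
  qed
  define t where "t = (b + csqrt (b^2 - 4)) / 2"
  have "(2 * t - b)^2 = b^2 - 4" unfolding t_def by (simp add: field_simps)
  then have "4 * (t * (b - t) - 1) = 0" by (simp add: power2_eq_square algebra_simps)
  then have t: "t * (b - t) = 1" by simp
  define c where "c = csqrt t"
  have "t \<noteq> 0" using t by auto
  then have c: "c \<noteq> 0" "c^2 = t" by (simp_all add: c_def)
  have bc: "b = c^2 + inverse (c^2)" unfolding c(2) using inverse_unique[OF t] by simp
  have coords: "p = moduli_coordinates (a1, a2, a3, c)"
    unfolding moduli_coordinates_def prod.case bc[symmetric] p using q a b by simp
  have "gamma_acts_freely a1 a2 a3 c"
    unfolding gamma_acts_freely_iff burniat_discriminant[OF c(1)] bc[symmetric]
    using h3 unfolding b q a .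
  moreover have "{a1, a2, a3} \<inter> {2, - 2} = {}"
  proof -
    have "64 - 16 * u1 + 4 * u2 - u3 = (4 - a1^2) * (4 - a2^2) * (4 - a3^2)"
      unfolding q a by algebra
    then have "4 - a1^2 \<noteq> 0" "4 - a2^2 \<noteq> 0" "4 - a3^2 \<noteq> 0" using h4 by auto
    then show ?thesis by auto
  qed
  ultimately show "p \<in> moduli_coordinates ` burniat_parameters"
    unfolding coords burniat_parameters_def using c(1) by blast
qed

end

theory Submission
  imports Defs
begin

text \<open>
  Irreducibility. Put \<open>b = c^2 + c^{-2}\<close>, which takes every complex value. The moduli coordinates
  are polynomials in \<open>(a1, a2, a3, b)\<close>, the two equations hold for all values of these
  parameters, and every point of the moduli space arises in this way. Hence the moduli space is the trace of a principal open set on the image of affine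
  4-space under a polynomial map. Such a set is irreducible
  (\<open>zariski_irreducible_polynomial_image\<close>): two points of it are joined by the image of a line,
  and finitely many nonzero polynomials in one variable over \<open>\<complex>\<close> have a common point where
  none of them vanishes.

  Rationality. Away from \<open>u3 = 0\<close> the equation \<open>u3 v = w^2\<close> is solved by \<open>w = u3 t\<close>,
  \<open>v = u3 t^2\<close> with \<open>t\<close> free. It remains to see that the threefold \<open>disc(u1, u2, u3) = d^2\<close>,
  which is the quotient of the space of triples \<open>(r1, r2, r3)\<close> by cyclic permutations, is rational.
  With a primitive cube root of unity \<open>\<omega>\<close> the Lagrange resolvents
  \<open>\<alpha> = r1 + \<omega> r2 + \<omega>^2 r3\<close> and \<open>\<beta> = r1 + \<omega>^2 r2 + \<omega> r3\<close> are eigenvectors of the cyclic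
  permutation with inverse eigenvalues, so the field of invariants is generated by \<open>s = u1\<close>,
  \<open>f = \<alpha>^3\<close> and \<open>g = \<beta> / \<alpha>^2\<close>. Here
  \<open>\<alpha> \<beta> = u1^2 - 3 u2\<close>, \<open>\<alpha>^3 + \<beta>^3 = 2 u1^3 - 9 u1 u2 + 27 u3\<close>, and
  \<open>\<alpha>^3 - \<beta>^3\<close> is \<open>d\<close> times a square root of \<open>-27\<close>. Since \<open>\<alpha> \<beta> = f g\<close> and
  \<open>\<beta>^3 = f^2 g^3\<close>, all six coordinates are polynomials in \<open>(s, g, f, t)\<close>, and this
  polynomial map is inverse to a rational map that is defined where \<open>f\<close> and \<open>u3\<close> do not vanish.
\<close>

section \<open>Polynomial functions and the Zariski topology\<close>

lemma polynomial_functions_minus: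
  "f \<in> polynomial_functions n \<Longrightarrow> (\<lambda>p. - f p) \<in> polynomial_functions n"
  using polynomial_functions.mult[OF polynomial_functions.const[of "- 1"]] by simp

lemma polynomial_functions_diff:
  "f \<in> polynomial_functions n \<Longrightarrow> g \<in> polynomial_functions n
    \<Longrightarrow> (\<lambda>p. f p - g p) \<in> polynomial_functions n"
  using polynomial_functions.add[OF _ polynomial_functions_minus] by simp

lemma polynomial_functions_divide_const:
  "f \<in> polynomial_functions n \<Longrightarrow> (\<lambda>p. f p / a) \<in> polynomial_functions n"
  using polynomial_functions.mult[OF _ polynomial_functions.const[of "inverse a"]]
  by (simp add: divide_inverse)

lemma polynomial_functions_power:
  "f \<in> polynomial_functions n \<Longrightarrow> (\<lambda>p. f p ^ k) \<in> polynomial_functions n"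
  by (induction k) (auto intro: polynomial_functions.intros)

lemmas polynomial_functions_intros = polynomial_functions.intros polynomial_functions_minus
  polynomial_functions_diff polynomial_functions_divide_const polynomial_functions_power

text \<open>
  A polynomial map from affine \<open>m\<close>-space to affine \<open>n\<close>-space. Its values are lists, and their
  length \<open>n\<close> is part of the condition.
\<close>

definition polynomial_map :: "nat \<Rightarrow> nat \<Rightarrow> (complex list \<Rightarrow> complex list) \<Rightarrow> bool" where
  "polynomial_map m n \<Psi> \<longleftrightarrow> \<Psi> ` affine_space m \<subseteq> affine_space n \<and>
     (\<forall>i<n. (\<lambda>p. \<Psi> p ! i) \<in> polynomial_functions m)"

lemma polynomial_functions_compose:
  assumes "f \<in> polynomial_functions n" "polynomial_map m n \<Psi>"
  shows "(\<lambda>p. f (\<Psi> p)) \<in> polynomial_functions m"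
  using assms(1)
proof induction
  case (coord i)
  then show ?case using assms(2) by (simp add: polynomial_map_def)
qed (auto intro: polynomial_functions.intros)

lemma polynomial_function_on_line:
  assumes "f \<in> polynomial_functions n" "length x = n" "length y = n"
  shows "\<exists>P. \<forall>t. f (map2 (\<lambda>a b. a + t * (b - a)) x y) = poly P t"
  using assms(1)
proof induction
  case (const a)
  show ?case by (rule exI[of _ "[:a:]"]) simp
next
  case (coord i)
  then show ?case using assms(2,3) by (intro exI[of _ "[:x ! i, y ! i - x ! i:]"]) simp
next
  case (add f g)
  then show ?case by (metis poly_add)
next
  case (mult f g)
  then show ?case by (metis poly_mult)
qed

lemma closedin_zariski:
  "closedin (zariski n) C \<longleftrightarrow> (\<exists>F\<subseteq>polynomial_functions n. C = zero_locus n F)"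
proof
  assume "closedin (zariski n) C"
  then have C: "C \<subseteq> affine_space n"
    and "openin (zariski n) (affine_space n - C)"
    by (simp_all add: closedin_def topspace_zariski)
  then obtain F where F: "F \<subseteq> polynomial_functions n"
    "affine_space n - C = affine_space n - zero_locus n F"
    unfolding openin_zariski by blast
  moreover have "zero_locus n F \<subseteq> affine_space n" by (auto simp: zero_locus_def)
  ultimately show "\<exists>F\<subseteq>polynomial_functions n. C = zero_locus n F" using C by blast
next
  assume "\<exists>F\<subseteq>polynomial_functions n. C = zero_locus n F"
  moreover have "zero_locus n F \<subseteq> affine_space n" for F by (auto simp: zero_locus_def)
  ultimately show "closedin (zariski n) C"
    unfolding closedin_def topspace_zariski openin_zariski by blast
qed

lemma openin_zariski_nonzero:
  assumes "h \<in> polynomial_functions n"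
  shows "openin (zariski n) {p \<in> affine_space n. h p \<noteq> 0}"
  unfolding openin_zariski
  by (rule exI[of _ "{h}"]) (use assms in \<open>auto simp: zero_locus_def\<close>)

lemma openin_subtopology_zariski_nonzero:
  assumes "h \<in> polynomial_functions n" "V \<subseteq> affine_space n"
  shows "openin (subtopology (zariski n) V) {p \<in> V. h p \<noteq> 0}"
  unfolding openin_subtopology
  by (rule exI[of _ "{p \<in> affine_space n. h p \<noteq> 0}"])
    (use assms openin_zariski_nonzero in auto)

text \<open>A proper closed subset of \<open>V\<close> lies in a hypersurface that does not contain \<open>V\<close>.\<close>

lemma proper_closedin_subtopology_zariskiE:
  assumes "closedin (subtopology (zariski n) V) A" "A \<noteq> V" "V \<subseteq> affine_space n"
  obtains f p where "f \<in> polynomial_functions n" "\<forall>x\<in>A. f x = 0" "p \<in> V" "f p \<noteq> 0"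
proof -
  obtain F where F: "F \<subseteq> polynomial_functions n" "A = zero_locus n F \<inter> V"
    using assms(1) unfolding closedin_subtopology closedin_zariski by blast
  then obtain p where p: "p \<in> V" "p \<notin> zero_locus n F" using assms(2) by blast
  then obtain f where "f \<in> F" "f p \<noteq> 0" using assms(3) by (auto simp: zero_locus_def)
  moreover from this have "f \<in> polynomial_functions n" "\<forall>x\<in>A. f x = 0"
    using F by (auto simp: zero_locus_def)
  ultimately show thesis using that p(1) by blast
qed

text \<open>
  If \<open>V\<close> were the union of two proper closed subsets, there would be functions \<open>f\<close> and \<open>g\<close>, one
  for each subset, with \<open>f * g = 0\<close> on \<open>V\<close>, although \<open>f\<close> is not zero at \<open>\<Psi> x\<close> and \<open>g\<close> is not
  zero at \<open>\<Psi> y\<close>. Restricting to the line through \<open>x\<close> and \<open>y\<close> reduces this to polynomials in one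
  variable, where a product of nonzero factors is not zero.
\<close>

lemma zariski_irreducible_polynomial_image:
  assumes \<Psi>: "polynomial_map m n \<Psi>" and h: "h \<in> polynomial_functions n"
    and V: "V = {p \<in> \<Psi> ` affine_space m. h p \<noteq> 0}" and ne: "V \<noteq> {}"
  shows "zariski_irreducible n V"
  unfolding zariski_irreducible_def
proof (intro conjI allI impI ne)
  fix A B
  assume A: "closedin (subtopology (zariski n) V) A"
    and B: "closedin (subtopology (zariski n) V) B" and AB: "V = A \<union> B"
  have sub: "V \<subseteq> affine_space n" using V \<Psi> by (auto simp: polynomial_map_def)
  show "A = V \<or> B = V"
  proof (rule ccontr)
    assume "\<not> (A = V \<or> B = V)"
    then have neq: "A \<noteq> V" "B \<noteq> V" by auto
    obtain f p where f: "f \<in> polynomial_functions n" "\<forall>x\<in>A. f x = 0"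
      and p: "p \<in> V" "f p \<noteq> 0"
      using proper_closedin_subtopology_zariskiE[OF A neq(1) sub] .
    obtain g q where g: "g \<in> polynomial_functions n" "\<forall>x\<in>B. g x = 0"
      and q: "q \<in> V" "g q \<noteq> 0"
      using proper_closedin_subtopology_zariskiE[OF B neq(2) sub] .
    obtain x y where x: "x \<in> affine_space m" "p = \<Psi> x" and y: "y \<in> affine_space m" "q = \<Psi> y"
      using p(1) q(1) V by blast
    define line where "line t = map2 (\<lambda>a b. a + t * (b - a)) x y" for t
    have len: "length x = m" "length y = m" using x y by (auto simp: affine_space_def)
    have line: "line t \<in> affine_space m" for t
      using len by (simp add: line_def affine_space_def)
    have ends: "line 0 = x" "line 1 = y"
      using len by (auto simp: line_def intro: nth_equalityI)
    have "\<exists>P. \<forall>t. k (\<Psi> (line t)) = poly P t" if "k \<in> polynomial_functions n" for k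
      using polynomial_function_on_line[OF polynomial_functions_compose[OF that \<Psi>] len]
      by (simp add: line_def)
    then obtain P Q H where PQH: "\<And>t. f (\<Psi> (line t)) = poly P t"
      "\<And>t. g (\<Psi> (line t)) = poly Q t" "\<And>t. h (\<Psi> (line t)) = poly H t"
      using f g h by metis
    have "poly P 0 \<noteq> 0" "poly Q 1 \<noteq> 0" "poly H 0 \<noteq> 0"
      using p q x y V by (auto simp: PQH[symmetric] ends)
    then have "P * Q * H \<noteq> 0" by auto
    then obtain t where t: "poly (P * Q * H) t \<noteq> 0" using poly_all_0_iff_0 by blast
    then have nz: "f (\<Psi> (line t)) \<noteq> 0" "g (\<Psi> (line t)) \<noteq> 0" "h (\<Psi> (line t)) \<noteq> 0"
      by (simp_all add: PQH)
    then have "\<Psi> (line t) \<in> V" using line V by auto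
    then show False using nz f(2) g(2) AB by blast
  qed
qed

lemma quasi_affine_variety_affine_space: "quasi_affine_variety n (affine_space n)"
proof -
  have "zariski_irreducible n (affine_space n)"
  proof (rule zariski_irreducible_polynomial_image)
    show "polynomial_map n n (\<lambda>p. p)"
      by (auto simp: polynomial_map_def intro: polynomial_functions.coord)
    show "(\<lambda>_. 1) \<in> polynomial_functions n" by (rule polynomial_functions.const)
    have "replicate n 0 \<in> affine_space n" by (simp add: affine_space_def)
    then show "affine_space n \<noteq> {}" by blast
  qed simp
  moreover have "openin (zariski n) (affine_space n)" "closedin (zariski n) (affine_space n)"
    using openin_topspace[of "zariski n"] closedin_topspace[of "zariski n"]
    by (simp_all add: topspace_zariski)
  ultimately show ?thesis unfolding quasi_affine_variety_def by blast
qed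

lemma regular_function_quotient:
  assumes "g \<in> polynomial_functions n" "h \<in> polynomial_functions n" "V \<subseteq> affine_space n"
    and "\<And>p. p \<in> V \<Longrightarrow> h p \<noteq> 0 \<and> f p = g p / h p"
  shows "regular_function n V f"
proof -
  have "openin (subtopology (zariski n) V) V"
    using openin_topspace[of "subtopology (zariski n) V"] assms(3)
    by (simp add: topspace_zariski Int_absorb1)
  then show ?thesis unfolding regular_function_def using assms by blast
qed

lemma morphism_polynomial_map:
  assumes "polynomial_map m n \<Psi>" "V \<subseteq> affine_space m" "\<Psi> ` V \<subseteq> W"
  shows "morphism m V n W \<Psi>"
  unfolding morphism_def
proof (intro conjI allI impI assms(3))
  fix i assume "i < n"
  then have "(\<lambda>p. \<Psi> p ! i) \<in> polynomial_functions m"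
    using assms(1) by (simp add: polynomial_map_def)
  then show "regular_function m V (\<lambda>p. \<Psi> p ! i)"
    by (rule regular_function_quotient[OF _ polynomial_functions.const[of 1] assms(2)]) simp
qed

section \<open>The moduli space is a quasi-affine variety\<close>

text \<open>
  The difference of the two sides of the discriminant equation, and the product of the two
  expressions that must not vanish, as functions of the point. The entries of \<open>p\<close> are, in this
  order, \<open>u1, u2, u3, d, v, w\<close>.
\<close>

definition discriminant_equation :: "complex list \<Rightarrow> complex" where
  "discriminant_equation p = - 4 * (p!0)^3 * (p!2) + (p!0)^2 * (p!1)^2
     + 18 * (p!0) * (p!1) * (p!2) - 4 * (p!1)^3 - 27 * (p!2)^2 - (p!3)^2"

definition nondegeneracy :: "complex list \<Rightarrow> complex" where
  "nondegeneracy p = (((p!4) - (p!0))^2 + (p!1) * ((p!4) - 4) + (p!2) + ((p!0) + (p!4) - 8) * (p!5))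
     * (64 - 16 * (p!0) + 4 * (p!1) - (p!2))"

lemma polynomial_functions_discriminant_equation:
  "discriminant_equation \<in> polynomial_functions 6"
  unfolding discriminant_equation_def[abs_def]
  by (intro polynomial_functions_intros) simp_all

lemma polynomial_functions_nondegeneracy: "nondegeneracy \<in> polynomial_functions 6"
  unfolding nondegeneracy_def[abs_def] by (intro polynomial_functions_intros) simp_all

lemma length_6_eq:
  assumes "length p = 6"
  shows "p = [p!0, p!1, p!2, p!3, p!4, p!5]"
  using assms by (auto simp: eval_nat_numeral length_Suc_conv)

lemma length_4_eq:
  assumes "length p = 4"
  shows "p = [p!0, p!1, p!2, p!3]"
  using assms by (auto simp: eval_nat_numeral length_Suc_conv)

lemma burniat_moduli_space_iff:
  "p \<in> burniat_moduli_space \<longleftrightarrow> p \<in> affine_space 6 \<and> discriminant_equation p = 0 \<and>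
     (p!2) * (p!4) - (p!5)^2 = 0 \<and> nondegeneracy p \<noteq> 0"
proof
  assume "p \<in> burniat_moduli_space"
  then show "p \<in> affine_space 6 \<and> discriminant_equation p = 0 \<and>
     (p!2) * (p!4) - (p!5)^2 = 0 \<and> nondegeneracy p \<noteq> 0"
    by (auto simp: burniat_moduli_space_def affine_space_def discriminant_equation_def
        nondegeneracy_def)
next
  assume R: "p \<in> affine_space 6 \<and> discriminant_equation p = 0 \<and>
     (p!2) * (p!4) - (p!5)^2 = 0 \<and> nondegeneracy p \<noteq> 0"
  then have "p = [p!0, p!1, p!2, p!3, p!4, p!5]"
    by (intro length_6_eq) (simp add: affine_space_def)
  then show "p \<in> burniat_moduli_space"
    using R unfolding burniat_moduli_space_def discriminant_equation_def nondegeneracy_def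
    by (simp only: mem_Collect_eq mult_eq_0_iff de_Morgan_disj right_minus_eq) blast
qed

text \<open>The moduli coordinates as polynomials in \<open>(a1, a2, a3, b)\<close>, where \<open>b = c^2 + c^{-2}\<close>.\<close>

definition parameter_map :: "complex list \<Rightarrow> complex list" where
  "parameter_map q =
     [(q!0)^2 + (q!1)^2 + (q!2)^2,
      (q!0)^2 * (q!1)^2 + (q!0)^2 * (q!2)^2 + (q!1)^2 * (q!2)^2,
      (q!0)^2 * (q!1)^2 * (q!2)^2,
      ((q!0)^2 - (q!1)^2) * ((q!1)^2 - (q!2)^2) * ((q!2)^2 - (q!0)^2),
      (q!3)^2,
      (q!0) * (q!1) * (q!2) * (q!3)]"

lemma all_less_6: "(\<forall>i<6. P i) \<longleftrightarrow> P 0 \<and> P 1 \<and> P 2 \<and> P 3 \<and> P 4 \<and> P (5::nat)"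
  by (auto simp: eval_nat_numeral All_less_Suc)

lemma all_less_4: "(\<forall>i<4. P i) \<longleftrightarrow> P 0 \<and> P 1 \<and> P 2 \<and> P (3::nat)"
  by (auto simp: eval_nat_numeral All_less_Suc)

lemma polynomial_map_parameter_map: "polynomial_map 4 6 parameter_map"
  unfolding polynomial_map_def all_less_6
  by (auto simp: parameter_map_def affine_space_def intro!: polynomial_functions_intros)

lemma burniat_moduli_space_eq_parameter_image:
  "burniat_moduli_space = {p \<in> parameter_map ` affine_space 4. nondegeneracy p \<noteq> 0}"
proof (intro equalityI subsetI)
  fix p assume p: "p \<in> burniat_moduli_space"
  then obtain a1 a2 a3 c where "p = moduli_coordinates (a1, a2, a3, c)"
    unfolding burniat_moduli_space_eq_image by auto
  then have "p = parameter_map [a1, a2, a3, c^2 + inverse (c^2)]"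
    by (simp add: moduli_coordinates_def parameter_map_def)
  moreover have "[a1, a2, a3, c^2 + inverse (c^2)] \<in> affine_space 4"
    by (simp add: affine_space_def)
  ultimately show "p \<in> {p \<in> parameter_map ` affine_space 4. nondegeneracy p \<noteq> 0}"
    using p by (auto simp: burniat_moduli_space_iff)
next
  fix p assume p: "p \<in> {p \<in> parameter_map ` affine_space 4. nondegeneracy p \<noteq> 0}"
  then obtain q where q: "p = parameter_map q" "q \<in> affine_space 4" by blast
  define A B C where "A = (q!0)^2" and "B = (q!1)^2" and "C = (q!2)^2"
  have coords: "p!0 = A + B + C" "p!1 = A * B + A * C + B * C" "p!2 = A * B * C"
    "p!3 = (A - B) * (B - C) * (C - A)"
    by (simp_all add: q parameter_map_def A_def B_def C_def)
  have "discriminant_equation p = 0"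
    unfolding discriminant_equation_def coords by algebra
  moreover have "(p!2) * (p!4) - (p!5)^2 = 0"
    by (simp add: q parameter_map_def power_mult_distrib)
  moreover have "p \<in> affine_space 6"
    using q polynomial_map_parameter_map by (auto simp: polynomial_map_def)
  ultimately show "p \<in> burniat_moduli_space" using p by (simp add: burniat_moduli_space_iff)
qed

section \<open>A rational parametrisation by Lagrange resolvents\<close>

text \<open>
  The polynomial map \<open>(s, g, f, t) \<mapsto> (u1, u2, u3, d, v, w)\<close>. For the resolvents one has
  \<open>f = \<alpha>^3\<close>, \<open>f * g = \<alpha> * \<beta>\<close> and \<open>f^2 * g^3 = \<beta>^3\<close>; the choice of the square root of
  \<open>-27\<close> only decides which of the two resolvents is called \<open>\<alpha>\<close>.
\<close>

definition resolvent_param :: "complex list \<Rightarrow> complex list" where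
  "resolvent_param q =
    (let s = q!0; g = q!1; f = q!2; t = q!3;
         u3 = (f + f^2 * g^3 + s^3 - 3 * s * f * g) / 27
     in [s, (s^2 - f * g) / 3, u3, (f - f^2 * g^3) / csqrt (- 27), u3 * t^2, u3 * t])"

text \<open>The resolvent cube \<open>\<alpha>^3\<close> in terms of \<open>u1, u2, u3, d\<close>.\<close>

definition resolvent_cube :: "complex list \<Rightarrow> complex" where
  "resolvent_cube p =
     (2 * (p!0)^3 - 9 * (p!0) * (p!1) + 27 * (p!2) + csqrt (- 27) * (p!3)) / 2"

text \<open>
  The inverse rational map, \<open>s = u1\<close>, \<open>g = (\<alpha> * \<beta>) / \<alpha>^3\<close>, \<open>f = \<alpha>^3\<close>, \<open>t = w / u3\<close>. It is
  meaningful where \<open>resolvent_cube\<close> and \<open>u3\<close> do not vanish.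
\<close>

definition resolvent_coords :: "complex list \<Rightarrow> complex list" where
  "resolvent_coords p =
     [p!0, ((p!0)^2 - 3 * (p!1)) / resolvent_cube p, resolvent_cube p, (p!5) / (p!2)]"

lemma polynomial_functions_resolvent_cube: "resolvent_cube \<in> polynomial_functions 6"
  unfolding resolvent_cube_def[abs_def] by (intro polynomial_functions_intros) simp_all

lemma polynomial_map_resolvent_param: "polynomial_map 4 6 resolvent_param"
  unfolding polynomial_map_def all_less_6
  by (auto simp: resolvent_param_def Let_def affine_space_def intro!: polynomial_functions_intros)

lemma resolvent_param_equations:
  "discriminant_equation (resolvent_param q) = 0"
  "(resolvent_param q ! 2) * (resolvent_param q ! 4) - (resolvent_param q ! 5)^2 = 0"
proof -
  define s g f u1 u2 u3 d where "s = q!0" and "g = q!1" and "f = q!2"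
    and "u1 = resolvent_param q ! 0" and "u2 = resolvent_param q ! 1"
    and "u3 = resolvent_param q ! 2" and "d = resolvent_param q ! 3"
  note defs = s_def g_def f_def u1_def u2_def u3_def d_def
  \<comment> \<open>The cube of the other resolvent.\<close>
  define f' where "f' = f^2 * g^3"
  have k: "csqrt (- 27)^2 = - 27" by (rule power2_csqrt)
  have u1: "u1 = s" by (simp add: defs resolvent_param_def Let_def)
  have u2: "u2 = (s^2 - f * g) / 3" by (simp add: defs resolvent_param_def Let_def)
  have u3: "u3 = (f + f' + s^3 - 3 * s * f * g) / 27"
    by (simp add: defs f'_def resolvent_param_def Let_def)
  have u2': "3 * u2 = s^2 - f * g" and u3': "27 * u3 = f + f' + s^3 - 3 * s * f * g"
    unfolding u2 u3 by simp_all
  have d: "d = (f - f') / csqrt (- 27)"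
    by (simp add: defs f'_def resolvent_param_def Let_def)
  have "27 * d^2 = - ((f - f')^2)" unfolding d power_divide k by simp
  moreover have "u1^2 - 3 * u2 = f * g" unfolding u1 u2' by simp
  moreover have "2 * u1^3 - 9 * u1 * u2 + 27 * u3 = f + f'"
    unfolding u1 using u2' u3' by algebra
  \<comment> \<open>The classical relation between the discriminant of a cubic and its resolvents.\<close>
  moreover have "27 * discriminant_equation (resolvent_param q) =
      4 * (u1^2 - 3 * u2)^3 - (2 * u1^3 - 9 * u1 * u2 + 27 * u3)^2 - 27 * d^2"
    unfolding discriminant_equation_def u1_def[symmetric] u2_def[symmetric] u3_def[symmetric]
      d_def[symmetric] by algebra
  ultimately have "27 * discriminant_equation (resolvent_param q) =
      4 * (f * g)^3 - (f + f')^2 + (f - f')^2" by simp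
  also have "\<dots> = 0" unfolding f'_def by algebra
  finally show "discriminant_equation (resolvent_param q) = 0" by simp
  show "(resolvent_param q ! 2) * (resolvent_param q ! 4) - (resolvent_param q ! 5)^2 = 0"
    unfolding resolvent_param_def Let_def by (simp add: power2_eq_square)
qed

lemma resolvent_cube_param: "resolvent_cube (resolvent_param q) = q!2"
proof -
  have "csqrt (- 27) \<noteq> 0" by simp
  then show ?thesis
    unfolding resolvent_cube_def resolvent_param_def Let_def
    by (simp add: field_simps power2_eq_square power3_eq_cube)
qed

lemma resolvent_coords_param:
  assumes "q \<in> affine_space 4" "q!2 \<noteq> 0" "resolvent_param q ! 2 \<noteq> 0"
  shows "resolvent_coords (resolvent_param q) = q"
proof -
  have "q = [q!0, q!1, q!2, q!3]" using assms(1) by (intro length_4_eq) (simp add: affine_space_def)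
  moreover have "resolvent_coords (resolvent_param q) = [q!0, q!1, q!2, q!3]"
    unfolding resolvent_coords_def resolvent_cube_param
    using assms(2,3)
    by (simp add: resolvent_param_def Let_def diff_divide_distrib right_diff_distrib)
  ultimately show ?thesis by simp
qed

lemma resolvent_param_coords:
  assumes p: "p \<in> affine_space 6"
    and eqs: "discriminant_equation p = 0" "(p!2) * (p!4) - (p!5)^2 = 0"
    and nz: "resolvent_cube p \<noteq> 0" "p!2 \<noteq> 0"
  shows "resolvent_param (resolvent_coords p) = p"
proof -
  define u1 u2 u3 d v w k f where "u1 = p!0" and "u2 = p!1" and "u3 = p!2" and "d = p!3"
    and "v = p!4" and "w = p!5" and "k = csqrt (- 27)" and "f = resolvent_cube p"
  note defs = u1_def u2_def u3_def d_def v_def w_def k_def f_def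
  have k: "k^2 = - 27" unfolding k_def by (rule power2_csqrt)
  then have k0: "k \<noteq> 0" by auto
  have f: "f = (2 * u1^3 - 9 * u1 * u2 + 27 * u3 + k * d) / 2"
    by (simp add: resolvent_cube_def defs)
  have nz': "f \<noteq> 0" "u3 \<noteq> 0" using nz by (simp_all add: defs)
  define f' where "f' = (2 * u1^3 - 9 * u1 * u2 + 27 * u3 - k * d) / 2"
  have disc: "- 4 * u1^3 * u3 + u1^2 * u2^2 + 18 * u1 * u2 * u3 - 4 * u2^3 - 27 * u3^2 = d^2"
    using eqs(1) by (simp add: discriminant_equation_def defs)
  \<comment> \<open>The other resolvent cube \<open>f'\<close> satisfies \<open>f * f' = (\<alpha> * \<beta>)^3\<close>.\<close>
  have "4 * (f * f') = (2 * u1^3 - 9 * u1 * u2 + 27 * u3)^2 - k^2 * d^2"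
    unfolding f f'_def by (simp add: field_simps power2_eq_square)
  also have "\<dots> = 4 * (u1^2 - 3 * u2)^3"
    unfolding k disc[symmetric] by algebra
  finally have ff': "f * f' = (u1^2 - 3 * u2)^3" by simp
  define g where "g = (u1^2 - 3 * u2) / f"
  have fg: "f * g = u1^2 - 3 * u2" using nz' by (simp add: g_def)
  have "f * (f^2 * g^3) = (f * g)^3" by algebra
  also have "\<dots> = f * f'" using fg ff' by simp
  finally have f2g3: "f^2 * g^3 = f'" using nz' by simp
  have "f + f' = 2 * u1^3 - 9 * u1 * u2 + 27 * u3"
    unfolding f f'_def by (simp add: field_simps)
  then have "f + f' + u1^3 - 3 * u1 * f * g = 27 * u3" using fg by algebra
  then have u3: "(f + f^2 * g^3 + u1^3 - 3 * u1 * f * g) / 27 = u3"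
    unfolding f2g3 by simp
  have u2: "(u1^2 - f * g) / 3 = u2" unfolding fg by simp
  have d: "(f - f^2 * g^3) / k = d" unfolding f2g3 using k0 by (simp add: f f'_def field_simps)
  have v: "u3 * (w / u3)^2 = v"
    using eqs(2) nz' by (simp add: defs power_divide field_simps power2_eq_square)
  have w: "u3 * (w / u3) = w" using nz' by simp
  have "resolvent_coords p = [u1, g, f, w / u3]"
    by (simp add: resolvent_coords_def g_def defs)
  moreover have "resolvent_param [u1, g, f, w / u3] =
      (let z = (f + f^2 * g^3 + u1^3 - 3 * u1 * f * g) / 27
       in [u1, (u1^2 - f * g) / 3, z, (f - f^2 * g^3) / k, z * (w / u3)^2, z * (w / u3)])"
    by (simp add: resolvent_param_def k_def Let_def)
  ultimately have "resolvent_param (resolvent_coords p) = [u1, u2, u3, d, v, w]"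
    unfolding Let_def u2 u3 d v w by simp
  also have "\<dots> = p"
    unfolding defs using p by (intro length_6_eq[symmetric]) (simp add: affine_space_def)
  finally show ?thesis .
qed

lemma quasi_affine_variety_burniat_moduli_space: "quasi_affine_variety 6 burniat_moduli_space"
proof -
  \<comment> \<open>This parameter gives \<open>(u1, u2, u3) = (0, 0, 1)\<close> and \<open>v = w = 0\<close>, so both inequations hold.\<close>
  have point: "resolvent_param [0, 0, 27, 0] \<in> burniat_moduli_space"
    unfolding burniat_moduli_space_iff
    using resolvent_param_equations[of "[0, 0, 27, 0]"]
    by (auto simp: affine_space_def nondegeneracy_def resolvent_param_def)
  have "zariski_irreducible 6 burniat_moduli_space"
    by (rule zariski_irreducible_polynomial_image[OF polynomial_map_parameter_map
          polynomial_functions_nondegeneracy burniat_moduli_space_eq_parameter_image])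
      (use point in blast)
  moreover have "closedin (zariski 6)
      (zero_locus 6 {discriminant_equation, \<lambda>p. (p!2) * (p!4) - (p!5)^2})"
    unfolding closedin_zariski
  proof (rule exI, rule conjI[OF _ refl])
    have "(\<lambda>p. (p!2) * (p!4) - (p!5)^2) \<in> polynomial_functions 6"
      by (intro polynomial_functions_intros) simp_all
    then show "{discriminant_equation, \<lambda>p. (p!2) * (p!4) - (p!5)^2} \<subseteq> polynomial_functions 6"
      using polynomial_functions_discriminant_equation by simp
  qed
  moreover have "burniat_moduli_space =
      zero_locus 6 {discriminant_equation, \<lambda>p. (p!2) * (p!4) - (p!5)^2}
        \<inter> {p \<in> affine_space 6. nondegeneracy p \<noteq> 0}"
    by (auto simp: burniat_moduli_space_iff zero_locus_def)
  ultimately show ?thesis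
    unfolding quasi_affine_variety_def
    using openin_zariski_nonzero[OF polynomial_functions_nondegeneracy] by blast
qed

lemma birational_burniat_moduli_space:
  "birational 6 burniat_moduli_space 4 (affine_space 4)"
proof -
  define V where "V = {p \<in> burniat_moduli_space. resolvent_cube p * (p!2) \<noteq> 0}"
  define W where "W = {q \<in> affine_space 4. (q!2) * (resolvent_param q ! 2)
    * nondegeneracy (resolvent_param q) \<noteq> 0}"
  have M: "burniat_moduli_space \<subseteq> affine_space 6" by (auto simp: burniat_moduli_space_iff)
  have cube: "(\<lambda>p. resolvent_cube p) \<in> polynomial_functions 6"
    using polynomial_functions_resolvent_cube by simp
  have V_open: "openin (subtopology (zariski 6) burniat_moduli_space) V"
    unfolding V_def
    by (intro openin_subtopology_zariski_nonzero M polynomial_functions.mult cube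
        polynomial_functions.coord) simp
  have "(\<lambda>q. resolvent_param q ! 2) \<in> polynomial_functions 4"
    using polynomial_map_resolvent_param by (simp add: polynomial_map_def)
  then have W_open: "openin (subtopology (zariski 4) (affine_space 4)) W"
    unfolding W_def
    by (intro openin_subtopology_zariski_nonzero order_refl polynomial_functions.mult
        polynomial_functions.coord polynomial_functions_compose[OF
          polynomial_functions_nondegeneracy polynomial_map_resolvent_param]) simp_all
  have param: "resolvent_param q \<in> V" if "q \<in> W" for q
    using that resolvent_param_equations[of q] polynomial_map_resolvent_param
    by (auto simp: V_def W_def burniat_moduli_space_iff resolvent_cube_param polynomial_map_def)
  have param_coords: "resolvent_param (resolvent_coords p) = p" if "p \<in> V" for p
    using that by (intro resolvent_param_coords) (auto simp: V_def burniat_moduli_space_iff)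
  have coords_param: "resolvent_coords (resolvent_param q) = q" if "q \<in> W" for q
    using that by (intro resolvent_coords_param) (auto simp: W_def)
  have coords: "resolvent_coords p \<in> W" if "p \<in> V" for p
    using that param_coords[OF that]
    by (auto simp: W_def V_def burniat_moduli_space_iff affine_space_def)
      (auto simp: resolvent_coords_def)
  have "\<forall>i<4. regular_function 6 V (\<lambda>p. resolvent_coords p ! i)"
    unfolding all_less_4
  proof (intro conjI)
    have V6: "V \<subseteq> affine_space 6" using M by (auto simp: V_def)
    show "regular_function 6 V (\<lambda>p. resolvent_coords p ! 0)"
      by (rule regular_function_quotient[OF polynomial_functions.coord[of 0]
            polynomial_functions.const[of 1] V6]) (simp_all add: resolvent_coords_def)
    have "(\<lambda>p. (p!0)^2 - 3 * (p!1)) \<in> polynomial_functions 6"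
      by (intro polynomial_functions_intros) simp_all
    then show "regular_function 6 V (\<lambda>p. resolvent_coords p ! 1)"
      by (rule regular_function_quotient[OF _ cube V6])
        (simp add: resolvent_coords_def V_def)
    show "regular_function 6 V (\<lambda>p. resolvent_coords p ! 2)"
      by (rule regular_function_quotient[OF cube polynomial_functions.const[of 1] V6])
        (simp add: resolvent_coords_def)
    show "regular_function 6 V (\<lambda>p. resolvent_coords p ! 3)"
      by (rule regular_function_quotient[OF polynomial_functions.coord[of 5]
            polynomial_functions.coord[of 2] V6]) (simp_all add: resolvent_coords_def V_def)
  qed
  then have "morphism 6 V 4 W resolvent_coords"
    using coords by (auto simp: morphism_def)
  moreover have "morphism 4 W 6 V resolvent_param"
    by (rule morphism_polynomial_map[OF polynomial_map_resolvent_param])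
      (use param in \<open>auto simp: W_def\<close>)
  ultimately have iso: "isomorphic_varieties 6 V 4 W"
    unfolding isomorphic_varieties_def using param_coords coords_param by blast
  \<comment> \<open>This parameter gives the point with \<open>(u1, u2, u3) = (0, 0, 1)\<close> and \<open>v = w = 0\<close>.\<close>
  have "[0, 0, 27, 0] \<in> W"
    by (simp add: W_def affine_space_def resolvent_param_def nondegeneracy_def)
  then have "W \<noteq> {}" "V \<noteq> {}" using param by blast+
  then show ?thesis
    unfolding birational_def
    using quasi_affine_variety_burniat_moduli_space quasi_affine_variety_affine_space
      V_open W_open iso by blast
qed

theorem corollary4p3:
  shows "rational_variety 6 burniat_moduli_space"
  unfolding rational_variety_def using birational_burniat_moduli_space by blast

end
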